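(* Let $k$ be an odd positive integer. For every integer $n>0$, let $b=\lfloor \log_2 n\rfloor$ and $c=n+1-2^{b}$. Then $$d_k(n)=\frac{(2^b+c)^k+(2^b-c)^k-(2^b+c-1)^k-(2^b-c+1)^k}{2^{b+1}}.$$
   Context: A P-position of the game of Nim with $k$ piles is a $k$-tuple $(p_1,\dots,p_k)$ of non-negative integers whose nim-sum $p_1\oplus\cdots\oplus p_k$ is $0$, where $\oplus$ denotes bitwise XOR. $d_k(n)$ denotes the number of P-positions with $k$ piles whose largest pile has exactly $n$ counters. *)

theory Defs
  imports Complex_Main
begin

unbundle bit_operations_syntax

definition nim_sum :: "nat list \<Rightarrow> nat" where
  "nim_sum ps = foldr (XOR) ps 0"

text \<open>A position is an ordered tuple of pile sizes (piles may be empty), represented as a list.\<close>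

definition P_positions :: "nat \<Rightarrow> nat list set" where
  "P_positions k = {ps. length ps = k \<and> nim_sum ps = 0}"

text \<open>For \<open>k = 0\<close> there is no largest pile and the value of \<open>d\<close> is irrelevant.\<close>

definition d :: "nat \<Rightarrow> nat \<Rightarrow> nat" where
  "d k n = card {ps \<in> P_positions k. Max (set ps) = n}"

lemma finite_P_positions_Max: "finite {ps \<in> P_positions k. Max (set ps) = n}"
proof (rule finite_subset)
  show "{ps \<in> P_positions k. Max (set ps) = n} \<subseteq> {ps. set ps \<subseteq> {..n} \<and> length ps = k}"
    by (auto simp: P_positions_def)
  show "finite {ps. set ps \<subseteq> {..n} \<and> length ps = k}"
    by (rule finite_lists_length_eq) simp
qed

end

theory Submission
  imports Defs
begin

text \<open>
  Put \<open>B = 2\<^sup>b\<close> and count the tuples with all piles below \<open>B + c\<close>, where \<open>0 \<le> c \<le> B\<close>.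
  The nim-sum is \<open>0\<close> only if an even number \<open>j\<close> of piles contain the bit \<open>B\<close>; as \<open>k\<close> is odd,
  some pile ranges freely over \<open>{0..<B}\<close> and is determined by the others. This gives
  \<open>(k choose j) c\<^sup>j B\<^bsup>k-j-1\<^esup>\<close> tuples for each even \<open>j\<close>, in total
  \<open>((B + c)\<^sup>k + (B - c)\<^sup>k) / (2 B)\<close>. Take the difference of the counts for
  \<open>c\<close> and \<open>c - 1\<close>.
\<close>

text \<open>The nim-sum \<open>v\<close> is arbitrary because removing a first pile \<open>x\<close>
  changes the target to \<open>x XOR v\<close>.\<close>

definition nim_tuples :: "nat \<Rightarrow> nat \<Rightarrow> nat \<Rightarrow> nat list set" where
  "nim_tuples m k v = {ps. length ps = k \<and> set ps \<subseteq> {..<m} \<and> nim_sum ps = v}"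

lemma finite_nim_tuples: "finite (nim_tuples m k v)"
  by (rule finite_subset[OF _ finite_lists_length_eq[of "{..<m}" k]])
     (auto simp: nim_tuples_def)

lemma nim_sum_Cons: "nim_sum (x # ps) = x XOR nim_sum ps"
  by (simp add: nim_sum_def)

lemma xor_eq_iff: "x XOR y = v \<longleftrightarrow> y = x XOR v" for x y v :: nat
  by (metis xor.left_neutral xor.assoc xor_self_eq)

lemma nim_tuples_Suc:
  "nim_tuples m (Suc k) v = (\<Union>x<m. (#) x ` nim_tuples m k (x XOR v))"
proof (rule set_eqI)
  fix ps
  show "ps \<in> nim_tuples m (Suc k) v \<longleftrightarrow> ps \<in> (\<Union>x<m. (#) x ` nim_tuples m k (x XOR v))"
    by (cases ps) (auto simp: nim_tuples_def nim_sum_Cons xor_eq_iff)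
qed

lemma card_nim_tuples_0: "card (nim_tuples m 0 v) = of_bool (v = 0)"
proof -
  have "nim_tuples m 0 v = (if v = 0 then {[]} else {})"
    by (auto simp: nim_tuples_def nim_sum_def)
  then show ?thesis by simp
qed

lemma card_nim_tuples_Suc:
  "card (nim_tuples m (Suc k) v) = (\<Sum>x<m. card (nim_tuples m k (x XOR v)))"
  unfolding nim_tuples_Suc
  by (subst card_UN_disjoint) (auto simp: finite_nim_tuples card_image)

definition dyadic_block :: "nat \<Rightarrow> nat \<Rightarrow> nat set" where
  "dyadic_block b e = {v. v div 2 ^ b = e}"

lemma div_xor: "(x XOR y) div 2 ^ b = (x div 2 ^ b) XOR (y div 2 ^ b)" for x y :: nat
  using drop_bit_xor[of b x y] by (simp add: drop_bit_eq_div)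

lemma dyadic_block_0: "dyadic_block b 0 = {..<2 ^ b}"
  by (auto simp: dyadic_block_def div_eq_0_iff)

lemma finite_dyadic_block: "finite (dyadic_block b e)"
proof (rule finite_subset)
  show "dyadic_block b e \<subseteq> {..<Suc e * 2 ^ b}"
    unfolding dyadic_block_def by (auto simp: div_less_iff_less_mult[symmetric] simp del: mult_Suc)
qed simp

text \<open>XOR with \<open>x\<close> is an involution and commutes with \<open>div 2 ^ b\<close>,
  so it carries each block bijectively onto another.\<close>

lemma sum_dyadic_block_xor:
  "(\<Sum>v\<in>dyadic_block b e. f (x XOR v)) = (\<Sum>v\<in>dyadic_block b (x div 2 ^ b XOR e). f v)"
  by (rule sum.reindex_bij_witness[of _ "\<lambda>v. x XOR v" "\<lambda>v. x XOR v"])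
     (auto simp: dyadic_block_def div_xor xor.assoc[symmetric])

lemma sum_lessThan_split:
  fixes f :: "nat \<Rightarrow> real"
  assumes "l \<le> m"
  shows "(\<Sum>x<m. f x) = (\<Sum>x<l. f x) + (\<Sum>x\<in>{l..<m}. f x)"
  using sum.atLeastLessThan_concat[of 0 l m f] assms by (simp add: lessThan_atLeast0)

text \<open>For \<open>2 ^ b \<le> m \<le> 2 * 2 ^ b\<close> and \<open>e \<le> 1\<close> this is
  the number of \<open>k\<close>-tuples of piles below \<open>m\<close> in which the number of piles
  containing the bit \<open>2 ^ b\<close> has parity \<open>e\<close>: the even or odd part of the
  binomial expansion of \<open>(2 ^ b + (m - 2 ^ b)) ^ k\<close>.\<close>

definition block_total :: "nat \<Rightarrow> nat \<Rightarrow> nat \<Rightarrow> nat \<Rightarrow> real" where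
  "block_total b m k e = (real m ^ k + (- 1) ^ e * (2 * 2 ^ b - real m) ^ k) / 2"

lemma block_total_Suc:
  assumes "e \<le> 1"
  shows "block_total b m (Suc k) e =
    2 ^ b * block_total b m k e + (real m - 2 ^ b) * block_total b m k (1 - e)"
  using assms by (cases e) (auto simp: block_total_def field_simps)

lemma top_block_div: "2 ^ b \<le> x \<Longrightarrow> x < 2 * 2 ^ b \<Longrightarrow> x div 2 ^ b = 1" for x :: nat
  by (intro div_nat_eqI) auto

lemma xor_1_le_1: "1 XOR e = 1 - e" if "e \<le> 1" for e :: nat
  using that by (cases e) auto

text \<open>Summing over a whole block forgets the lower bits of the nim-sum, so only the parity of
  the number of piles with the bit \<open>2 ^ b\<close> remains. No parity condition on
  \<open>k\<close> arises.\<close>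

lemma sum_block_card_nim_tuples:
  assumes m: "2 ^ b \<le> m" "m \<le> 2 * 2 ^ b"
  shows "e \<le> 1 \<Longrightarrow> (\<Sum>v\<in>dyadic_block b e. real (card (nim_tuples m k v))) = block_total b m k e"
proof (induction k arbitrary: e)
  case 0
  have "(\<Sum>v\<in>dyadic_block b e. real (card (nim_tuples m 0 v))) = of_bool (e = 0)"
    using finite_dyadic_block[of b e]
    by (simp add: card_nim_tuples_0 of_bool_def if_distrib[of real] dyadic_block_def cong: if_cong)
  then show ?case using 0 by (cases e) (auto simp: block_total_def)
next
  case (Suc k)
  have "(\<Sum>v\<in>dyadic_block b e. real (card (nim_tuples m (Suc k) v)))
      = (\<Sum>x<m. \<Sum>v\<in>dyadic_block b e. real (card (nim_tuples m k (x XOR v))))"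
    by (simp add: card_nim_tuples_Suc sum.swap[of _ _ "{..<m}"])
  also have "\<dots> = (\<Sum>x<m. \<Sum>v\<in>dyadic_block b (x div 2 ^ b XOR e). real (card (nim_tuples m k v)))"
    by (simp add: sum_dyadic_block_xor[of "\<lambda>v. real (card (nim_tuples m k v))"])
  \<comment> \<open>A first pile below \<open>2 ^ b\<close> keeps the block index; any other flips
    it.\<close>
  also have "\<dots> = (\<Sum>x<2 ^ b :: nat. block_total b m k e) + (\<Sum>x\<in>{2 ^ b..<m}. block_total b m k (1 - e))"
    unfolding sum_lessThan_split[OF m(1)]
  proof (intro arg_cong2[of _ _ _ _ "(+)"] sum.cong refl)
    fix x assume "x \<in> {..<2 ^ b :: nat}"
    then show "(\<Sum>v\<in>dyadic_block b (x div 2 ^ b XOR e). real (card (nim_tuples m k v))) =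
        block_total b m k e"
      using Suc.IH[OF Suc.prems] by simp
  next
    fix x assume "x \<in> {2 ^ b..<m}"
    then have "x div 2 ^ b = 1" using m(2) by (intro top_block_div) auto
    then show "(\<Sum>v\<in>dyadic_block b (x div 2 ^ b XOR e). real (card (nim_tuples m k v))) =
        block_total b m k (1 - e)"
      by (simp only: xor_1_le_1[OF Suc.prems] Suc.IH diff_le_self)
  qed
  also have "\<dots> = block_total b m (Suc k) e"
    using m Suc.prems by (simp add: block_total_Suc of_nat_diff)
  finally show ?case .
qed

text \<open>
  If the parities of \<open>k\<close> and of the block index differ, some pile lies in the lower block, so the
  tuples are equidistributed over the nim-sums in that block.
\<close>

lemma card_nim_tuples_equidistributed:
  assumes m: "2 ^ b \<le> m" "m \<le> 2 * 2 ^ b"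
  shows "v div 2 ^ b \<le> 1 \<Longrightarrow> odd (k + v div 2 ^ b) \<Longrightarrow>
    2 ^ b * real (card (nim_tuples m k v)) = block_total b m k (v div 2 ^ b)"
proof (induction k arbitrary: v)
  case 0
  \<comment> \<open>Oddness forces the upper block, where both sides are 0: the empty tuple has
    nim-sum 0.\<close>
  then have e: "v div 2 ^ b = 1" by (cases "v div 2 ^ b") auto
  then have "v \<noteq> 0" by (intro notI) simp
  with e show ?case by (simp add: card_nim_tuples_0 block_total_def)
next
  case (Suc k)
  define e where "e = v div 2 ^ b"
  have e: "e \<le> 1" using Suc.prems by (simp add: e_def)
  \<comment> \<open>For a low first pile, \<open>x XOR v\<close> runs through the whole block of
    \<open>v\<close>, so the block sum applies without the induction hypothesis.\<close>
  have "(\<Sum>x<2 ^ b. real (card (nim_tuples m k (x XOR v)))) =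
      (\<Sum>x\<in>dyadic_block b 0. real (card (nim_tuples m k (v XOR x))))"
    by (simp add: dyadic_block_0 xor.commute)
  also have "\<dots> = block_total b m k e"
    by (simp add: sum_dyadic_block_xor[of "\<lambda>v. real (card (nim_tuples m k v))"]
        sum_block_card_nim_tuples[OF m e] flip: e_def)
  finally have low: "(\<Sum>x<2 ^ b. real (card (nim_tuples m k (x XOR v)))) = block_total b m k e" .
  \<comment> \<open>A high first pile flips the block index while the length drops by one, so the
    parity condition survives.\<close>
  have high: "2 ^ b * real (card (nim_tuples m k (x XOR v))) = block_total b m k (1 - e)"
    if x: "x \<in> {2 ^ b..<m}" for x
  proof -
    have "(x XOR v) div 2 ^ b = 1 - e"
      using top_block_div[of b x] x m(2) xor_1_le_1[OF e] by (auto simp add: div_xor simp flip: e_def)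
    moreover have "odd (k + (1 - e))"
      using Suc.prems(2) e unfolding e_def[symmetric] by (cases e) auto
    ultimately show ?thesis using Suc.IH[of "x XOR v"] by simp
  qed
  have "2 ^ b * real (card (nim_tuples m (Suc k) v)) =
      2 ^ b * block_total b m k e +
      (\<Sum>x\<in>{2 ^ b..<m}. 2 ^ b * real (card (nim_tuples m k (x XOR v))))"
    by (simp add: card_nim_tuples_Suc sum_lessThan_split[OF m(1)] low distrib_left sum_distrib_left)
  also have "\<dots> = block_total b m (Suc k) e"
    using m e by (simp add: high block_total_Suc of_nat_diff)
  finally show ?case by (simp add: e_def)
qed

lemma card_nim_tuples_odd:
  assumes "2 ^ b \<le> m" "m \<le> 2 * 2 ^ b" "odd k"
  shows "real (card (nim_tuples m k 0)) =
    (real m ^ k + (2 * 2 ^ b - real m) ^ k) / 2 ^ (b + 1)"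
  using card_nim_tuples_equidistributed[OF assms(1,2), of 0 k] assms(3)
  by (simp add: block_total_def field_simps)

lemma d_eq_diff:
  assumes "k > 0"
  shows "d k n = card (nim_tuples (Suc n) k 0) - card (nim_tuples n k 0)"
proof -
  have "Max (set ps) = n \<longleftrightarrow> set ps \<subseteq> {..<Suc n} \<and> \<not> set ps \<subseteq> {..<n}"
    if "length ps = k" for ps :: "nat list"
  proof -
    have "set ps \<noteq> {}" using that assms by auto
    then show ?thesis
      by (auto simp: Max_eq_iff less_Suc_eq_le subset_iff)
  qed
  then have "{ps \<in> P_positions k. Max (set ps) = n} = nim_tuples (Suc n) k 0 - nim_tuples n k 0"
    by (auto simp: P_positions_def nim_tuples_def)
  moreover have "nim_tuples n k 0 \<subseteq> nim_tuples (Suc n) k 0"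
    by (auto simp: nim_tuples_def)
  ultimately show ?thesis
    by (simp add: d_def card_Diff_subset finite_nim_tuples)
qed

text \<open>Ensures that the subtraction of naturals in \<open>d_eq_diff\<close> does not
  truncate.\<close>

lemma card_nim_tuples_mono: "card (nim_tuples n k v) \<le> card (nim_tuples (Suc n) k v)"
  by (rule card_mono[OF finite_nim_tuples]) (auto simp: nim_tuples_def)

theorem theorem16:
  fixes k n b :: nat and c :: int
  assumes "odd k"
    and "n > 0"
    and "b = nat \<lfloor>log 2 (real n)\<rfloor>"
    and "c = int n + 1 - 2 ^ b"
  shows "real (d k n) =
    real_of_int ((2 ^ b + c) ^ k + (2 ^ b - c) ^ k - (2 ^ b + c - 1) ^ k - (2 ^ b - c + 1) ^ k)
      / 2 ^ (b + 1)"
proof -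
  \<comment> \<open>As \<open>n \<ge> 1\<close>, the logarithm is nonnegative and \<open>nat\<close>
    loses nothing.\<close>
  have "\<lfloor>log 2 (real n)\<rfloor> = int b"
    using assms(2,3) by (simp add: zero_le_log_cancel_iff)
  then have b: "2 ^ b \<le> n" "n < 2 * 2 ^ b"
    using floor_log_nat_eq_powr_iff[of 2 n b] assms(2) by auto
  have "k > 0" using assms(1) by (cases k) auto
  then have "real (d k n) = real (card (nim_tuples (Suc n) k 0)) - real (card (nim_tuples n k 0))"
    by (simp add: d_eq_diff of_nat_diff card_nim_tuples_mono)
  \<comment> \<open>Both bounds \<open>n\<close> and \<open>Suc n\<close> are admissible with the
    same \<open>b\<close>, even when \<open>Suc n\<close> equals \<open>2 * 2 ^ b\<close>.\<close>
  also have "\<dots> = (real (Suc n) ^ k + (2 * 2 ^ b - real (Suc n)) ^ k) / 2 ^ (b + 1)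
      - (real n ^ k + (2 * 2 ^ b - real n) ^ k) / 2 ^ (b + 1)"
    using b assms(1) by (subst (1 2) card_nim_tuples_odd) auto
  \<comment> \<open>Here \<open>Suc n = 2 ^ b + c\<close>, hence
    \<open>2 * 2 ^ b - Suc n = 2 ^ b - c\<close>.\<close>
  also have "\<dots> = real_of_int ((2 ^ b + c) ^ k + (2 ^ b - c) ^ k
      - (2 ^ b + c - 1) ^ k - (2 ^ b - c + 1) ^ k) / 2 ^ (b + 1)"
    by (simp add: assms(4) diff_divide_distrib add_divide_distrib algebra_simps)
  finally show ?thesis .
qed

end
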